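(* Let $\mathscr{H}$ be a (real or complex) Hilbert space and let $A\in\mathbf{B}_+(\mathscr{H})$. For a given linear subspace $\mathscr{M}\subseteq\mathscr{H}$ denote by $P$ the orthogonal projection of $\mathscr{H}_A$ onto the closure of $\{Ax : x\in\mathscr{M}\}$ in $\mathscr{H}_A$. Then the short of $A$ to $\mathscr{M}^{\perp}$ equals $J_A(I-P)J_A^*$.
   Context: $\mathbf{B}_+(\mathscr{H})$ is the set of bounded positive (self-adjoint, $(Ax\,|\,x)\ge 0$) operators on $\mathscr{H}$, with $S\leq A$ iff $(Sx\,|\,x)\leq(Ax\,|\,x)$ for all $x$. For a closed linear subspace $\mathscr{N}\subseteq\mathscr{H}$, the short of $A$ to $\mathscr{N}$ is the greatest element (with respect to $\leq$) of the set $\{S\in\mathbf{B}_+(\mathscr{H}) : S\leq A,\ \operatorname{ran}S\subseteq\mathscr{N}\}$; it exists, and its quadratic form is $x\mapsto\inf_{y\in\mathscr{N}^{\perp}}(A(x-y)\,|\,x-y)$. $\mathscr{H}_A$ denotes the Hilbert space completion of the range space $\operatorname{ran}A$ equipped with the inner product $(Ax\,|\,Ay)_A:=(Ax\,|\,y)$, $x,y\in\mathscr{H}$. $J_A:\mathscr{H}_A\to\mathscr{H}$ is the unique continuous linear extension of the canonical embedding $\operatorname{ran}A\to\mathscr{H}$, $J_A(Ax):=Ax$. Its adjoint $J_A^*:\mathscr{H}\to\mathscr{H}_A$ satisfies $J_A^*x=Ax\in\operatorname{ran}A\subseteq\mathscr{H}_A$ for all $x\in\mathscr{H}$, and $A=J_AJ_A^*$.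 $I$ is the identity of $\mathscr{H}_A$. *)

theory Defs
  imports "HOL-Analysis.Analysis"
begin

section \<open>Real or complex scalars\<close>

text \<open>A normed field with an isometric, conjugation-compatible embedding into the complex
  numbers over the reals. The range of such an embedding is the real line or the whole complex
  plane (\<open>range_rc_emb\<close> below), so a type of this class is a copy of one of these two fields.\<close>

class rc_field = real_normed_field +
  fixes rc_emb :: "'a \<Rightarrow> complex" and rc_cnj :: "'a \<Rightarrow> 'a"
  assumes rc_emb_add: "rc_emb (a + b) = rc_emb a + rc_emb b"
    and rc_emb_mult: "rc_emb (a * b) = rc_emb a * rc_emb b"
    and rc_emb_one: "rc_emb 1 = 1"
    and rc_emb_scaleR: "rc_emb (r *\<^sub>R a) = r *\<^sub>R rc_emb a"
    and norm_rc_emb: "norm (rc_emb a) = norm a"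
    and rc_emb_cnj: "rc_emb (rc_cnj a) = cnj (rc_emb a)"

definition rc_re :: "'k::rc_field \<Rightarrow> real" where
  "rc_re a = Re (rc_emb a)"

instantiation real :: rc_field
begin
definition rc_emb_real :: "real \<Rightarrow> complex" where "rc_emb_real = of_real"
definition rc_cnj_real :: "real \<Rightarrow> real" where "rc_cnj_real = id"
instance
  by standard (simp_all add: rc_emb_real_def rc_cnj_real_def scaleR_conv_of_real)
end

instantiation complex :: rc_field
begin
definition rc_emb_complex :: "complex \<Rightarrow> complex" where "rc_emb_complex = id"
definition rc_cnj_complex :: "complex \<Rightarrow> complex" where "rc_cnj_complex = cnj"
instance
  by standard (simp_all add: rc_emb_complex_def rc_cnj_complex_def)
end

lemma rc_emb_of_real: "rc_emb (of_real r) = of_real r"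
  by (simp add: of_real_def rc_emb_scaleR rc_emb_one)

lemma range_rc_emb:
  "range (rc_emb :: 'k::rc_field \<Rightarrow> complex) = \<real> \<or>
   range (rc_emb :: 'k::rc_field \<Rightarrow> complex) = UNIV"
proof (cases "range (rc_emb :: 'k \<Rightarrow> complex) \<subseteq> \<real>")
  case True
  have "\<real> \<subseteq> range (rc_emb :: 'k \<Rightarrow> complex)"
    by (metis Reals_cases rangeI rc_emb_of_real subsetI)
  with True show ?thesis by blast
next
  case False
  then obtain a :: 'k where a: "rc_emb a \<notin> \<real>" by blast
  then have im: "Im (rc_emb a) \<noteq> 0" by (simp add: complex_is_Real_iff)
  have "z \<in> range (rc_emb :: 'k \<Rightarrow> complex)" for z
  proof -
    define t where "t = Im z / Im (rc_emb a)"
    define s where "s = Re z - t * Re (rc_emb a)"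
    have "rc_emb (of_real s + of_real t * a) = of_real s + of_real t * rc_emb a"
      by (simp only: rc_emb_add rc_emb_mult rc_emb_of_real)
    also have "\<dots> = z"
      using im by (simp add: complex_eq_iff s_def t_def)
    finally have "rc_emb (of_real s + of_real t * a) = z" .
    then show ?thesis by (metis rangeI)
  qed
  then show ?thesis by blast
qed

section \<open>Hilbert spaces over the scalars\<close>

text \<open>The norm of the complete normed space is the one induced by the inner product, which is
  linear in its first argument.\<close>

locale hilbert_space = vector_space scl
  for scl :: "'k::rc_field \<Rightarrow> 'h::{real_normed_vector,complete_space} \<Rightarrow> 'h" +
  fixes ip :: "'h \<Rightarrow> 'h \<Rightarrow> 'k"
  assumes scl_of_real: "scl (of_real r) x = r *\<^sub>R x"
    and ip_add_left: "ip (x + y) z = ip x z + ip y z"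
    and ip_scl_left: "ip (scl a x) y = a * ip x y"
    and ip_commute: "ip y x = rc_cnj (ip x y)"
    and ip_self: "ip x x = of_real ((norm x)\<^sup>2)"

lemma hilbert_space_real_inner:
  "hilbert_space (scaleR :: real \<Rightarrow> 'h \<Rightarrow> 'h) (inner :: 'h \<Rightarrow> 'h::{real_inner,complete_space} \<Rightarrow> real)"
proof -
  have "vector_space (scaleR :: real \<Rightarrow> 'h \<Rightarrow> 'h)"
    by standard (simp_all add: algebra_simps)
  then show ?thesis
    by (simp add: hilbert_space_def hilbert_space_axioms_def inner_add_left
        rc_cnj_real_def power2_norm_eq_inner) (simp add: inner_commute)
qed

lemma hilbert_space_complex: "hilbert_space ((*) :: complex \<Rightarrow> _) (\<lambda>z w. z * cnj w)"
proof -
  have "vector_space ((*) :: complex \<Rightarrow> complex \<Rightarrow> complex)"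
    by standard (simp_all add: algebra_simps)
  then show ?thesis
    by (simp add: hilbert_space_def hilbert_space_axioms_def algebra_simps
        rc_cnj_complex_def complex_norm_square scaleR_conv_of_real del: of_real_power)
qed

definition orth_compl :: "('h \<Rightarrow> 'h \<Rightarrow> 'k::rc_field) \<Rightarrow> 'h set \<Rightarrow> 'h set" where
  "orth_compl ip M = {x. \<forall>y\<in>M. ip x y = 0}"

section \<open>Positive operators and shorts\<close>

definition pos_ops ::
  "('k::rc_field \<Rightarrow> 'h::real_normed_vector \<Rightarrow> 'h) \<Rightarrow> ('h \<Rightarrow> 'h \<Rightarrow> 'k) \<Rightarrow> ('h \<Rightarrow> 'h) set" where
  "pos_ops scl ip = {T. Vector_Spaces.linear scl scl T \<and> bounded_linear T \<and>
     (\<forall>x y. ip (T x) y = ip x (T y)) \<and> (\<forall>x. 0 \<le> rc_re (ip (T x) x))}"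

text \<open>Self-adjointness makes the quadratic forms real-valued, so that comparing the real parts
  is comparing the forms themselves.\<close>

definition op_le :: "('h \<Rightarrow> 'h \<Rightarrow> 'k::rc_field) \<Rightarrow> ('h \<Rightarrow> 'h) \<Rightarrow> ('h \<Rightarrow> 'h) \<Rightarrow> bool" where
  "op_le ip S T \<longleftrightarrow> (\<forall>x. rc_re (ip (S x) x) \<le> rc_re (ip (T x) x))"

definition short_cands where
  "short_cands scl ip A N = {S \<in> pos_ops scl ip. op_le ip S A \<and> range S \<subseteq> N}"

text \<open>\<open>is_short scl ip A N S\<close>: the short of \<open>A\<close> to \<open>N\<close> exists and equals \<open>S\<close>
  (uniqueness: \<open>is_short_unique\<close>).\<close>

definition is_short ::
  "('k::rc_field \<Rightarrow> 'h::real_normed_vector \<Rightarrow> 'h) \<Rightarrow> ('h \<Rightarrow> 'h \<Rightarrow> 'k) \<Rightarrow>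
   ('h \<Rightarrow> 'h) \<Rightarrow> 'h set \<Rightarrow> ('h \<Rightarrow> 'h) \<Rightarrow> bool" where
  "is_short scl ip A N S \<longleftrightarrow>
     S \<in> short_cands scl ip A N \<and> (\<forall>T \<in> short_cands scl ip A N. op_le ip T S)"

lemma rc_re_add: "rc_re (a + b) = rc_re a + rc_re b"
  by (simp add: rc_re_def rc_emb_add)

lemma rc_re_cnj: "rc_re (rc_cnj a) = rc_re a"
  by (simp add: rc_re_def rc_emb_cnj)

lemma rc_re_of_real: "rc_re (of_real r) = r"
  by (simp add: rc_re_def rc_emb_of_real)

context hilbert_space
begin

lemma ip_re_commute: "rc_re (ip x y) = rc_re (ip y x)"
  by (metis ip_commute rc_re_cnj)

lemma ip_re_add_right: "rc_re (ip x (y + z)) = rc_re (ip x y) + rc_re (ip x z)"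
  by (metis ip_re_commute ip_add_left rc_re_add)

lemma op_le_antisym:
  assumes S: "S \<in> pos_ops scl ip" and T: "T \<in> pos_ops scl ip"
    and "op_le ip S T" and "op_le ip T S"
  shows "S = T"
proof
  fix x
  let ?f = "\<lambda>R u v. rc_re (ip (R u) v)"
  have lin: "R (u + v) = R u + R v" if "R \<in> pos_ops scl ip" for R u v
    using that by (simp add: pos_ops_def bounded_linear.linear linear_add)
  have sym: "?f R u v = ?f R v u" if "R \<in> pos_ops scl ip" for R u v
    using that ip_re_commute[of "R u" v] by (simp add: pos_ops_def)
  have pol: "?f R (u + v) (u + v) = ?f R u u + 2 * ?f R u v + ?f R v v"
    if "R \<in> pos_ops scl ip" for R u v
    using sym[OF that, of v u]
    by (simp add: lin[OF that] ip_add_left ip_re_add_right rc_re_add)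
  have diag: "?f S u u = ?f T u u" for u
    using assms(3,4) by (simp add: op_le_def order_antisym)
  have off: "?f S u v = ?f T u v" for u v
    using pol[OF S, of u v] pol[OF T, of u v] diag[of "u + v"] diag[of u] diag[of v] by linarith
  let ?d = "S x - T x"
  have "ip (S x) ?d = ip (?d + T x) ?d" by simp
  then have "rc_re (ip ?d ?d) = 0"
    using off[of x ?d] by (simp only: ip_add_left rc_re_add)
  then show "S x = T x"
    using ip_self[of ?d] rc_re_of_real[where 'a = 'k, of "(norm ?d)\<^sup>2"] by simp
qed

lemma is_short_unique:
  "is_short scl ip A N S \<Longrightarrow> is_short scl ip A N T \<Longrightarrow> S = T"
  by (rule op_le_antisym) (auto simp: is_short_def short_cands_def)

end

section \<open>The auxiliary space of a positive operator\<close>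

text \<open>A Hilbert space completion of \<open>range A\<close> under \<open>(A x | A y)\<^sub>A = (A x | y)\<close>, unique up to a
  unitary map, is given by a linear isometry \<open>\<iota>\<close> of \<open>range A\<close> into a Hilbert space
  \<open>(sclK, ipK)\<close> together with the closure \<open>K\<close> of its image. The completion is the subspace \<open>K\<close>
  and not the ambient type, because types cannot depend on \<open>A\<close>. Only the values of \<open>\<iota>\<close> on
  \<open>range A\<close>, and below only those of \<open>J\<close> and \<open>P\<close> on \<open>K\<close>, are relevant.\<close>

definition is_range_completion ::
  "('k::rc_field \<Rightarrow> 'h \<Rightarrow> 'h) \<Rightarrow> ('h \<Rightarrow> 'h \<Rightarrow> 'k) \<Rightarrow> ('h \<Rightarrow> 'h) \<Rightarrow>
   ('k \<Rightarrow> 'c \<Rightarrow> 'c) \<Rightarrow> ('c \<Rightarrow> 'c \<Rightarrow> 'k) \<Rightarrow> ('h::ab_group_add \<Rightarrow> 'c::real_normed_vector) \<Rightarrow>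
   'c set \<Rightarrow> bool" where
  "is_range_completion scl ip A sclK ipK \<iota> K \<longleftrightarrow>
     (\<forall>u\<in>range A. \<forall>v\<in>range A. \<iota> (u + v) = \<iota> u + \<iota> v) \<and>
     (\<forall>a. \<forall>u\<in>range A. \<iota> (scl a u) = sclK a (\<iota> u)) \<and>
     (\<forall>x y. ipK (\<iota> (A x)) (\<iota> (A y)) = ip (A x) y) \<and>
     K = closure (\<iota> ` range A)"

text \<open>\<open>J\<close> is the continuous linear extension to \<open>K\<close> of the inclusion of \<open>range A\<close>.\<close>

definition is_canonical_ext ::
  "('k::rc_field \<Rightarrow> 'h \<Rightarrow> 'h) \<Rightarrow> ('h \<Rightarrow> 'h) \<Rightarrow> ('k \<Rightarrow> 'c \<Rightarrow> 'c) \<Rightarrow>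
   ('h::real_normed_vector \<Rightarrow> 'c::real_normed_vector) \<Rightarrow> 'c set \<Rightarrow> ('c \<Rightarrow> 'h) \<Rightarrow> bool" where
  "is_canonical_ext scl A sclK \<iota> K J \<longleftrightarrow>
     (\<forall>u\<in>K. \<forall>v\<in>K. J (u + v) = J u + J v) \<and>
     (\<forall>a. \<forall>u\<in>K. J (sclK a u) = scl a (J u)) \<and>
     continuous_on K J \<and>
     (\<forall>x. J (\<iota> (A x)) = A x)"

definition is_adjoint_from ::
  "('c \<Rightarrow> 'c \<Rightarrow> 'k::rc_field) \<Rightarrow> 'c set \<Rightarrow> ('h \<Rightarrow> 'h \<Rightarrow> 'k) \<Rightarrow> ('c \<Rightarrow> 'h) \<Rightarrow> ('h \<Rightarrow> 'c) \<Rightarrow> bool"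
  where
  "is_adjoint_from ipK K ip J Jadj \<longleftrightarrow>
     (\<forall>x. Jadj x \<in> K \<and> (\<forall>u\<in>K. ip (J u) x = ipK u (Jadj x)))"

text \<open>\<open>P\<close> is the orthogonal projection of \<open>K\<close> onto its closed subspace \<open>L\<close>.\<close>

definition is_orth_proj ::
  "('c::minus \<Rightarrow> 'c \<Rightarrow> 'k::rc_field) \<Rightarrow> 'c set \<Rightarrow> 'c set \<Rightarrow> ('c \<Rightarrow> 'c) \<Rightarrow> bool" where
  "is_orth_proj ipK K L P \<longleftrightarrow> (\<forall>u\<in>K. P u \<in> L \<and> (\<forall>v\<in>L. ipK (u - P u) v = 0))"

end

(* The adjoint of J_A is x \<mapsto> A x, so the form of S = J_A (I - P) J_A^* is the squared distance in
   H_A from A x to the closure of A(M). This gives positivity and S \<le> A. A competitor T has range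
   orthogonal to M, hence vanishes on M by symmetry, so for every y in M
   (T x | x) = (T (x - y) | x - y) \<le> (A (x - y) | x - y) = \<parallel>A x - A y\<parallel>_A^2;
   passing to the limit A y \<rightarrow> P (A x) gives T \<le> S. *)

theory Submission
  imports Defs
begin

text \<open>An additive isometry has trivial kernel. Injectivity allows identities about
  \<open>rc_cnj\<close> to be checked after embedding into the complex numbers.\<close>

lemma inj_rc_emb: "inj (rc_emb :: 'k::rc_field \<Rightarrow> complex)"
proof (rule injI)
  fix a b :: 'k
  assume "rc_emb a = rc_emb b"
  moreover have "rc_emb a = rc_emb (a - b) + rc_emb b"
    by (simp flip: rc_emb_add)
  ultimately show "a = b"
    using norm_rc_emb[of "a - b"] by simp
qed

lemma rc_cnj_add: "rc_cnj (a + b) = rc_cnj a + rc_cnj b" for a b :: "'k::rc_field"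
  by (rule injD[OF inj_rc_emb]) (simp add: rc_emb_add rc_emb_cnj)

lemma rc_cnj_mult: "rc_cnj (a * b) = rc_cnj a * rc_cnj b" for a b :: "'k::rc_field"
  by (rule injD[OF inj_rc_emb]) (simp add: rc_emb_mult rc_emb_cnj)

lemma rc_cnj_mult_self: "rc_cnj a * a = of_real ((norm a)\<^sup>2)" for a :: "'k::rc_field"
proof (rule injD[OF inj_rc_emb])
  show "rc_emb (rc_cnj a * a) = rc_emb (of_real ((norm a)\<^sup>2) :: 'k)"
    using complex_norm_square[of "rc_emb a"]
    by (simp only: rc_emb_mult rc_emb_cnj rc_emb_of_real norm_rc_emb mult.commute)
qed

lemma norm_rc_cnj: "norm (rc_cnj a) = norm a" for a :: "'k::rc_field"
  by (metis norm_rc_emb rc_emb_cnj complex_mod_cnj)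

context hilbert_space
begin

lemma ip_zero_left: "ip 0 y = 0"
  using ip_add_left[of 0 0 y] by simp

lemma ip_diff_left: "ip (x - y) z = ip x z - ip y z"
  using ip_add_left[of "x - y" y z] by simp

lemma ip_add_right: "ip x (y + z) = ip x y + ip x z"
  by (metis ip_add_left ip_commute rc_cnj_add)

lemma ip_diff_right: "ip x (y - z) = ip x y - ip x z"
  using ip_add_right[of x "y - z" z] by simp

lemma ip_scl_right: "ip x (scl a y) = rc_cnj a * ip x y"
  by (metis ip_scl_left ip_commute rc_cnj_mult)

lemma ip_eq_zero_commute: "ip x y = 0 \<longleftrightarrow> ip y x = 0"
  by (metis ip_commute norm_eq_zero norm_rc_cnj)

lemma ip_self_eq_zero: "ip x x = 0 \<longleftrightarrow> x = 0"
  by (simp add: ip_self)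

lemma rc_re_ip_self: "rc_re (ip x x) = (norm x)\<^sup>2"
  by (simp only: ip_self rc_re_of_real)

lemma ip_ext:
  assumes "\<And>z. ip x z = ip y z"
  shows "x = y"
  using assms[of "x - y"] ip_self_eq_zero[of "x - y"] by (simp add: ip_diff_left)

lemma norm_add_power2: "(norm (x + y))\<^sup>2 = (norm x)\<^sup>2 + 2 * rc_re (ip x y) + (norm y)\<^sup>2"
  using rc_re_ip_self[of "x + y"] ip_re_commute[of x y]
  by (simp add: ip_add_left ip_add_right rc_re_add rc_re_ip_self)

text \<open>The type class makes the norm homogeneous for real scalars; for scalars in
  \<open>'k\<close> this comes from the inner product.\<close>

lemma norm_scl: "norm (scl a x) = norm a * norm x"
proof -
  have "ip (scl a x) (scl a x) = rc_cnj a * a * ip x x"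
    by (simp add: ip_scl_left ip_scl_right mult_ac)
  also have "\<dots> = of_real ((norm a * norm x)\<^sup>2)"
    by (simp only: rc_cnj_mult_self ip_self power_mult_distrib of_real_mult)
  finally have "(norm (scl a x))\<^sup>2 = (norm a * norm x)\<^sup>2"
    by (metis rc_re_ip_self rc_re_of_real)
  then show ?thesis by simp
qed

text \<open>Since the norm already satisfies the triangle inequality, Cauchy--Schwarz is read off
  from the expansion of \<open>(norm (x + y))\<^sup>2\<close>.\<close>

lemma rc_re_ip_le: "rc_re (ip x y) \<le> norm x * norm y"
  using power_mono[OF norm_triangle_ineq[of x y] norm_ge_zero, of 2]
  by (simp add: norm_add_power2 power2_sum)

text \<open>Scaling \<open>x\<close> by the conjugate of \<open>c = ip x y\<close> turns the inner
  product into the real number \<open>(norm c)\<^sup>2\<close>, so the bound on real parts applies;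
  one factor \<open>norm c\<close> then cancels.\<close>

lemma norm_ip_le: "norm (ip x y) \<le> norm x * norm y"
proof -
  define c where "c = ip x y"
  have "(norm c)\<^sup>2 = rc_re (ip (scl (rc_cnj c) x) y)"
    by (simp only: ip_scl_left rc_cnj_mult_self rc_re_of_real flip: c_def)
  also have "\<dots> \<le> norm c * (norm x * norm y)"
    using rc_re_ip_le[of "scl (rc_cnj c) x" y] by (simp add: norm_scl norm_rc_cnj mult_ac)
  finally show ?thesis
    by (cases "norm c = 0") (auto simp: power2_eq_square c_def)
qed

lemma bounded_linear_ip_left: "bounded_linear (\<lambda>x. ip x y)"
proof (rule bounded_linear_intro)
  show "ip (r *\<^sub>R x) y = r *\<^sub>R ip x y" for r x
    by (simp add: ip_scl_left scaleR_conv_of_real flip: scl_of_real)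
qed (rule ip_add_left norm_ip_le)+

lemma ip_eq_zero_closure:
  assumes "\<And>u. u \<in> U \<Longrightarrow> ip u d = 0" and "v \<in> closure U"
  shows "ip v d = 0"
proof -
  have "continuous_on (closure U) (\<lambda>x. ip x d)"
    using bounded_linear_ip_left by (rule bounded_linear.continuous_on) simp
  from continuous_constant_on_closure[OF this assms] show ?thesis .
qed

text \<open>Pythagoras for the decomposition \<open>u = (u - p) + p\<close>.\<close>

lemma norm_minus_orth_le:
  assumes "ip (u - p) p = 0"
  shows "norm (u - p) \<le> norm u"
proof -
  have "rc_re (ip (u - p) p) = 0"
    by (metis assms of_real_0 rc_re_of_real)
  then have "(norm (u - p))\<^sup>2 \<le> (norm u)\<^sup>2"
    using norm_add_power2[of "u - p" p] by simp
  then show ?thesis by simp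
qed

text \<open>Additivity and homogeneity come for free from symmetry, because the inner product
  separates points.\<close>

lemma symmetric_bounded_in_pos_ops:
  assumes "0 \<le> b"
    and sym: "\<And>x y. ip (S x) y = ip x (S y)"
    and pos: "\<And>x. 0 \<le> rc_re (ip (S x) x)"
    and bd: "\<And>x y. rc_re (ip (S x) y) \<le> b * norm x * norm y"
  shows "S \<in> pos_ops scl ip"
proof -
  have add: "S (x + y) = S x + S y" for x y
    by (rule ip_ext) (simp add: sym ip_add_left)
  have hom: "S (scl a x) = scl a (S x)" for a x
    by (rule ip_ext) (simp add: sym ip_scl_left)
  \<comment> \<open>Testing the form bound with \<open>y = S x\<close> bounds
    \<open>(norm (S x))\<^sup>2\<close>, and one factor \<open>norm (S x)\<close> cancels.\<close>
  have "norm (S x) \<le> norm x * b" for x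
    using bd[of x "S x"] \<open>0 \<le> b\<close>
    by (cases "norm (S x) = 0") (simp_all add: rc_re_ip_self power2_eq_square mult_ac)
  then have "bounded_linear S"
    by (intro bounded_linear_intro[where K = b]) (auto simp: add hom simp flip: scl_of_real)
  moreover have "Vector_Spaces.linear scl scl S"
    by (simp add: Vector_Spaces.linear_iff add hom vector_space_axioms)
  ultimately show ?thesis
    using sym pos by (simp add: pos_ops_def)
qed

end


text \<open>Subtraction is continuous. This keeps differences inside the completion, which is given
  as the closure of an image.\<close>

lemma diff_in_closure:
  fixes U :: "'a::real_normed_vector set"
  assumes "\<And>u v. u \<in> U \<Longrightarrow> v \<in> U \<Longrightarrow> u - v \<in> U"
    and "u \<in> closure U" "v \<in> closure U"
  shows "u - v \<in> closure U"
proof -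
  obtain f g where "\<forall>n. f n \<in> U" "f \<longlonglongrightarrow> u" "\<forall>n. g n \<in> U" "g \<longlonglongrightarrow> v"
    using assms(2,3) by (auto simp: closure_sequential)
  then have "\<forall>n. f n - g n \<in> U" "(\<lambda>n. f n - g n) \<longlonglongrightarrow> u - v"
    using assms(1) by (auto intro: tendsto_diff)
  then show ?thesis
    unfolding closure_sequential by (intro exI[of _ "\<lambda>n. f n - g n"]) simp
qed

theorem theorem2p5:
  fixes scl :: "'k::rc_field \<Rightarrow> 'h::{real_normed_vector,complete_space} \<Rightarrow> 'h"
    and ip :: "'h \<Rightarrow> 'h \<Rightarrow> 'k"
    and A :: "'h \<Rightarrow> 'h"
    and M :: "'h set"
    and sclK :: "'k \<Rightarrow> 'c::{real_normed_vector,complete_space} \<Rightarrow> 'c"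
    and ipK :: "'c \<Rightarrow> 'c \<Rightarrow> 'k"
    and \<iota> :: "'h \<Rightarrow> 'c"
    and K :: "'c set"
    and J :: "'c \<Rightarrow> 'h"
    and Jadj :: "'h \<Rightarrow> 'c"
    and P :: "'c \<Rightarrow> 'c"
  assumes "hilbert_space scl ip"
    and "A \<in> pos_ops scl ip"
    and "module.subspace scl M"
    and "hilbert_space sclK ipK"
    and "is_range_completion scl ip A sclK ipK \<iota> K"
    and "is_canonical_ext scl A sclK \<iota> K J"
    and "is_adjoint_from ipK K ip J Jadj"
    and "is_orth_proj ipK K (closure (\<iota> ` A ` M)) P"
  shows "is_short scl ip A (orth_compl ip M) (J \<circ> (\<lambda>u. u - P u) \<circ> Jadj)"
proof -
  interpret H: hilbert_space scl ip by fact
  interpret C: hilbert_space sclK ipK by fact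
  \<comment> \<open>\<open>j x\<close> is the vector \<open>A x\<close> regarded as an element of
    the completion \<open>K\<close>.\<close>
  define j where "j x = \<iota> (A x)" for x
  define L where "L = closure (j ` M)"
  define Q where "Q u = u - P u" for u
  have A_linear: "linear A" and A_bounded: "bounded_linear A"
    using assms(2) by (auto simp: pos_ops_def bounded_linear.linear)
  have \<iota>_add: "\<iota> (A x + A y) = j x + j y" for x y
    using assms(5) by (auto simp: is_range_completion_def j_def)
  have ipK_j: "ipK (j x) (j y) = ip (A x) y" for x y
    using assms(5) by (simp add: is_range_completion_def j_def)
  have K: "K = closure (range j)"
    using assms(5) by (simp add: is_range_completion_def j_def image_image)
  have j_diff: "j (x - y) = j x - j y" for x y
    using \<iota>_add[of "x - y" y] by (simp add: j_def linear_diff[OF A_linear])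
  have j_in_K: "j x \<in> K" for x
    using closure_subset[of "range j"] by (auto simp: K)
  have K_diff: "u - v \<in> K" if "u \<in> K" "v \<in> K" for u v
    using that unfolding K by (intro diff_in_closure) (auto simp flip: j_diff)
  have J_j: "J (j x) = A x" for x
    using assms(6) by (simp add: is_canonical_ext_def j_def)
  have Jadj_in_K: "Jadj x \<in> K" for x
    using assms(7) by (simp add: is_adjoint_from_def)
  have J_Jadj: "ip (J u) x = ipK u (Jadj x)" if "u \<in> K" for u x
    using assms(7) that by (simp add: is_adjoint_from_def)
  \<comment> \<open>Both vectors have the same inner products with the dense set
    \<open>range j\<close>. Their difference lies in \<open>K\<close>, so it is orthogonal to
    itself.\<close>
  have Jadj: "Jadj x = j x" for x
  proof -
    define d where "d = Jadj x - j x"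
    have "ipK u d = 0" if "u \<in> range j" for u
      using J_Jadj[OF j_in_K, of _ x] that by (auto simp: J_j ipK_j d_def C.ip_diff_right)
    moreover have "d \<in> closure (range j)"
      unfolding d_def K[symmetric] by (intro K_diff Jadj_in_K j_in_K)
    ultimately have "ipK d d = 0"
      by (rule C.ip_eq_zero_closure)
    then show ?thesis by (simp add: C.ip_self_eq_zero d_def)
  qed
  have L_sub: "L \<subseteq> K"
    unfolding L_def K by (intro closure_mono) auto
  have P_in_L: "P u \<in> L" and Q_orth: "\<And>v. v \<in> L \<Longrightarrow> ipK (Q u) v = 0" if "u \<in> K" for u
    using assms(8) that by (auto simp: is_orth_proj_def L_def j_def image_image Q_def)
  have Q_in_K: "Q u \<in> K" if "u \<in> K" for u
    unfolding Q_def using that P_in_L L_sub by (intro K_diff) auto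
  define S where "S = J \<circ> (\<lambda>u. u - P u) \<circ> Jadj"
  have ip_S_j: "ip (S x) y = ipK (Q (j x)) (j y)" for x y
    using J_Jadj[OF Q_in_K[OF j_in_K]] by (simp add: S_def Jadj Q_def)
  \<comment> \<open>The component \<open>P (j y)\<close> lies in \<open>L\<close>, to which
    \<open>Q (j x)\<close> is orthogonal, so it can be subtracted from \<open>j y\<close>. The form
    is now visibly symmetric and positive.\<close>
  have ip_S: "ip (S x) y = ipK (Q (j x)) (Q (j y))" for x y
    using Q_orth[OF j_in_K P_in_L[OF j_in_K]]
    by (simp add: ip_S_j Q_def[of "j y"] C.ip_diff_right)
  have S_form: "rc_re (ip (S x) x) = (norm (Q (j x)))\<^sup>2" for x
    by (simp add: ip_S C.rc_re_ip_self)
  have A_form: "rc_re (ip (A x) x) = (norm (j x))\<^sup>2" for x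
    by (simp add: C.rc_re_ip_self flip: ipK_j)
  have Q_le: "norm (Q (j x)) \<le> norm (j x)" for x
    unfolding Q_def using Q_orth[OF j_in_K P_in_L[OF j_in_K]]
    by (intro C.norm_minus_orth_le) (simp add: Q_def)
  obtain b where b: "b \<ge> 0" "norm (A x) \<le> norm x * b" for x
    using bounded_linear.nonneg_bounded[OF A_bounded] by blast
  \<comment> \<open>The square of \<open>norm (j x)\<close> is the quadratic form of
    \<open>A\<close>, hence the square root of the bound \<open>b\<close> of \<open>A\<close>. Two
    such factors give back \<open>b\<close> for \<open>S\<close>.\<close>
  have j_bound: "norm (j x) \<le> sqrt b * norm x" for x
  proof -
    have "(norm (j x))\<^sup>2 \<le> norm (A x) * norm x"
      using H.rc_re_ip_le[of "A x" x] by (simp add: A_form)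
    also have "\<dots> \<le> (norm x * b) * norm x"
      using b by (intro mult_right_mono) auto
    also have "\<dots> = (sqrt b * norm x)\<^sup>2"
      using b by (simp add: power_mult_distrib) (simp add: power2_eq_square)
    finally show ?thesis
      by (rule power2_le_imp_le) (simp add: b)
  qed
  have "S \<in> pos_ops scl ip"
  proof (rule H.symmetric_bounded_in_pos_ops)
    show "0 \<le> b" by fact
    show "ip (S x) y = ip x (S y)" for x y
      by (metis ip_S H.ip_commute C.ip_commute)
    show "0 \<le> rc_re (ip (S x) x)" for x
      by (simp add: S_form)
    show "rc_re (ip (S x) y) \<le> b * norm x * norm y" for x y
    proof -
      have "rc_re (ip (S x) y) \<le> norm (Q (j x)) * norm (Q (j y))"
        unfolding ip_S by (rule C.rc_re_ip_le)
      also have "\<dots> \<le> (sqrt b * norm x) * (sqrt b * norm y)"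
        using b by (intro mult_mono order_trans[OF Q_le j_bound]) auto
      also have "\<dots> = b * norm x * norm y"
        using b by simp
      finally show ?thesis .
    qed
  qed
  moreover have "op_le ip S A"
    using Q_le by (simp add: op_le_def S_form A_form power_mono)
  moreover have "range S \<subseteq> orth_compl ip M"
  proof -
    \<comment> \<open>The unsymmetric formula \<open>ip_S_j\<close> fits here: \<open>j y\<close>
      itself belongs to \<open>L\<close> when \<open>y\<close> is in \<open>M\<close>.\<close>
    have "ip (S x) y = 0" if "y \<in> M" for x y
      unfolding ip_S_j using that closure_subset[of "j ` M"]
      by (intro Q_orth j_in_K) (auto simp: L_def)
    then show ?thesis by (auto simp: orth_compl_def)
  qed
  moreover have "op_le ip T S" if T: "T \<in> short_cands scl ip A (orth_compl ip M)" for T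
    unfolding op_le_def
  proof
    fix x
    have T_linear: "linear T" and T_sym: "\<And>u v. ip (T u) v = ip u (T v)"
      using T by (auto simp: short_cands_def pos_ops_def bounded_linear.linear)
    have T_orth: "ip (T u) y = 0" if "y \<in> M" for u y
      using T that by (auto simp: short_cands_def orth_compl_def)
    have T_zero: "T y = 0" if "y \<in> M" for y
      using T_orth[OF that] by (intro H.ip_ext) (metis T_sym H.ip_eq_zero_commute H.ip_zero_left)
    have le: "rc_re (ip (T x) x) \<le> (norm (j x - j y))\<^sup>2" if "y \<in> M" for y
    proof -
      have "ip (T x) x = ip (T (x - y)) (x - y)"
        using that by (simp add: linear_diff[OF T_linear] T_zero T_orth H.ip_diff_right)
      also have "rc_re \<dots> \<le> rc_re (ip (A (x - y)) (x - y))"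
        using T by (simp add: short_cands_def op_le_def)
      finally show ?thesis by (simp add: A_form j_diff)
    qed
    have "closed {w. rc_re (ip (T x) x) \<le> (norm (j x - w))\<^sup>2}"
      by (intro closed_Collect_le continuous_intros)
    then have "L \<subseteq> {w. rc_re (ip (T x) x) \<le> (norm (j x - w))\<^sup>2}"
      unfolding L_def using le by (intro closure_minimal) auto
    then show "rc_re (ip (T x) x) \<le> rc_re (ip (S x) x)"
      using P_in_L[OF j_in_K, of x] by (auto simp: S_form Q_def)
  qed
  ultimately show ?thesis
    unfolding S_def[symmetric] by (simp add: is_short_def short_cands_def)
qed

end
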